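(* Let $G=(V,E)$ be a finite, simple, undirected, connected graph with at least two vertices, and let $X \subseteq V$ with $|X| = d \geq 3$ be such that $G[V\setminus X]$ is a disjoint union of cliques. If $X$ is an independent set in $G$, then $\chi_{ON}(G) \leq d+1$.
   Context: A CFON coloring of a graph $G=(V,E)$ with $k$ colors is a map $C: V \to \{1,\dots,k\}$ such that for every $v \in V$ there is a color $i$ with $|N(v)\cap C^{-1}(i)| = 1$, where $N(v)$ is the open neighborhood of $v$. $\chi_{ON}(G)$ is the minimum $k$ for which a CFON coloring with $k$ colors exists. *)

theory Defs
  imports
    "Graph_Theory.Digraph_Component"
    "HOL-Library.Extended_Nat"
    "HOL-Library.Disjoint_Sets"
begin

(* Undirected graphs are the symmetric digraphs of the locale graph, i.e. finite, loop-free,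
   without parallel arcs; an edge is a pair of opposite arcs.  Out-neighbors are therefore
   exactly the neighbors. *)

definition open_neighborhood :: "('a, 'b) pre_digraph \<Rightarrow> 'a \<Rightarrow> 'a set" where
  "open_neighborhood G v = {u \<in> verts G. v \<rightarrow>\<^bsub>G\<^esub> u}"

definition CFON_coloring :: "('a, 'b) pre_digraph \<Rightarrow> nat \<Rightarrow> ('a \<Rightarrow> nat) \<Rightarrow> bool" where
  "CFON_coloring G k C \<longleftrightarrow>
     C ` verts G \<subseteq> {1..k} \<and>
     (\<forall>v\<in>verts G. \<exists>i\<in>{1..k}. card {u \<in> open_neighborhood G v. C u = i} = 1)"

(* The infimum over the empty set is infinity: a graph with an isolated vertex has no CFON
   coloring at all.  Otherwise the infimum is attained and is the minimum. *)
definition chi_ON :: "('a, 'b) pre_digraph \<Rightarrow> enat" where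
  "chi_ON G = (INF k \<in> {k. \<exists>C. CFON_coloring G k C}. enat k)"

definition independent_set :: "('a, 'b) pre_digraph \<Rightarrow> 'a set \<Rightarrow> bool" where
  "independent_set G X \<longleftrightarrow> X \<subseteq> verts G \<and> (\<forall>u\<in>X. \<forall>v\<in>X. \<not> u \<rightarrow>\<^bsub>G\<^esub> v)"

definition clique :: "('a, 'b) pre_digraph \<Rightarrow> 'a set \<Rightarrow> bool" where
  "clique G K \<longleftrightarrow> K \<subseteq> verts G \<and> (\<forall>u\<in>K. \<forall>v\<in>K. u \<noteq> v \<longrightarrow> u \<rightarrow>\<^bsub>G\<^esub> v)"

definition disjoint_union_of_cliques :: "('a, 'b) pre_digraph \<Rightarrow> bool" where
  "disjoint_union_of_cliques G \<longleftrightarrow>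
     (\<exists>P. partition_on (verts G) P \<and>
          (\<forall>K\<in>P. clique G K) \<and>
          (\<forall>K\<in>P. \<forall>L\<in>P. K \<noteq> L \<longrightarrow> (\<forall>u\<in>K. \<forall>v\<in>L. \<not> u \<rightarrow>\<^bsub>G\<^esub> v)))"

end

theory Submission
  imports Defs
begin

text \<open>Use the elements of \<open>X\<close> and one neutral element as colors. Every \<open>x \<in> X\<close> needs a representative
  among its neighbors whose color is not repeated in its neighborhood. If no vertex outside \<open>X\<close> has
  two neighbors in \<open>X\<close>, color all of \<open>X\<close> neutrally, a representative of \<open>x\<close> by \<open>x\<close>, and make
  sure that each clique contains a vertex touching \<open>X\<close> whose color occurs only once in the clique.

  Otherwise choose \<open>r\<close> with a maximal number of neighbors in \<open>X\<close> and let it represent all of them,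
  so that the color of some \<open>e\<close> among them is not needed for representatives. Color each
  \<open>x \<in> X\<close> by \<open>x\<close>, but \<open>e\<close> neutrally. Representatives then see their own color in \<open>X\<close>, and
  a clique in which some free vertex is colored \<open>e\<close> is satisfied except possibly
  at this vertex. Taking the number of representatives minimal, and then the number of cliques on
  which this fails minimal, restricts these cliques so much that they can be repaired by one
  more color, apart from one configuration with \<open>|X| = 3\<close>, where another choice of \<open>e\<close> works.\<close>

section \<open>Abstract setting: cliques attached to \<open>X\<close>\<close>

lemma unique_colorI:
  assumes "a \<in> A" "D a = i" "\<And>w. \<lbrakk>w \<in> A; D w = i\<rbrakk> \<Longrightarrow> w = a"
  shows "\<exists>i. \<exists>!w. w \<in> A \<and> D w = i"
  using assms by blast

text \<open>\<open>P\<close> is the set of cliques outside \<open>X\<close> and \<open>S w\<close> the set of neighbors of \<open>w\<close> in \<open>X\<close>.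
  The last two assumptions are all that is used of connectedness.\<close>

locale clustered =
  fixes X :: "'a set" and P :: "'a set set" and S :: "'a \<Rightarrow> 'a set"
  assumes finite_X: "finite X" and card_X: "3 \<le> card X"
    and finite_W: "finite (\<Union>P)"
    and cliques_disjoint: "\<lbrakk>K \<in> P; L \<in> P; w \<in> K; w \<in> L\<rbrakk> \<Longrightarrow> K = L"
    and outside_X: "w \<in> \<Union>P \<Longrightarrow> w \<notin> X"
    and S_subset: "S w \<subseteq> X"
    and touching: "K \<in> P \<Longrightarrow> \<exists>w\<in>K. S w \<noteq> {}"
    and wide_neighbor: "x \<in> X \<Longrightarrow> \<exists>K\<in>P. (\<exists>w\<in>K. x \<in> S w) \<and> (\<exists>v\<in>K. \<not> S v \<subseteq> {x})"
begin

text \<open>This is a CFON coloring with \<open>card X + 1\<close> colors in terms of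
  \<open>P\<close> and \<open>S\<close>: by independence the neighbors of \<open>x \<in> X\<close>
  all lie in cliques, and those of \<open>v \<in> K\<close> are the rest of \<open>K\<close> and
  \<open>S v\<close>.\<close>

definition conflict_free :: "('a \<Rightarrow> 'a option) \<Rightarrow> bool" where
  "conflict_free D \<longleftrightarrow>
     D ` (X \<union> \<Union>P) \<subseteq> insert None (Some ` X) \<and>
     (\<forall>x\<in>X. \<exists>i. \<exists>!w. w \<in> \<Union>P \<and> x \<in> S w \<and> D w = i) \<and>
     (\<forall>K\<in>P. \<forall>v\<in>K. \<exists>i. \<exists>!w. w \<in> (K - {v}) \<union> S v \<and> D w = i)"

text \<open>The values of \<open>f\<close> are the representatives; each of them is \<open>f y\<close> for exactly one \<open>y \<in> C\<close>,
  and this \<open>y\<close> will be its color. The color \<open>e\<close> is not used by representatives.\<close>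

definition choice :: "('a \<Rightarrow> 'a) \<Rightarrow> 'a set \<Rightarrow> 'a \<Rightarrow> bool" where
  "choice f C e \<longleftrightarrow> (\<forall>x\<in>X. f x \<in> \<Union>P \<and> x \<in> S (f x)) \<and>
     C \<subseteq> X \<and> inj_on f C \<and> f ` C = f ` X \<and> e \<in> X - C"

definition colors :: "('a \<Rightarrow> 'a) \<Rightarrow> 'a set \<Rightarrow> 'a set \<Rightarrow> 'a set" where
  "colors f C K = {x \<in> C. f x \<in> K}"

definition free :: "('a \<Rightarrow> 'a) \<Rightarrow> 'a set \<Rightarrow> 'a set \<Rightarrow> 'a set" where
  "free f C K = K - f ` C"

text \<open>If a clique is not blocked, it suffices to give the color \<open>e\<close> to at most one of its free
  vertices and the neutral color to the others; if it is fixable, a second free vertex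
  receives the color \<open>j\<close>.\<close>

definition blocked :: "('a \<Rightarrow> 'a) \<Rightarrow> 'a set \<Rightarrow> 'a \<Rightarrow> 'a set \<Rightarrow> bool" where
  "blocked f C e K \<longleftrightarrow> free f C K \<noteq> {} \<and>
     (\<forall>u\<in>free f C K. S u - {e} = colors f C K) \<and>
     (\<forall>u. free f C K = {u} \<longrightarrow> e \<notin> S u)"

definition fixable :: "('a \<Rightarrow> 'a) \<Rightarrow> 'a set \<Rightarrow> 'a \<Rightarrow> 'a set \<Rightarrow> bool" where
  "fixable f C e K \<longleftrightarrow>
     (\<exists>u\<in>free f C K. \<exists>v\<in>free f C K. \<exists>j\<in>X. u \<noteq> v \<and> j \<noteq> e \<and> j \<notin> colors f C K \<and> j \<notin> S u \<and>
        (\<forall>x\<in>S v. j \<in> C \<longrightarrow> f x \<noteq> f j))"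

text \<open>The colors are the elements of \<open>X\<close> together with \<^term>\<open>None\<close>. A vertex \<open>x \<in> X\<close> gets
  the color \<open>x\<close>, except that \<open>e\<close> gets \<^term>\<open>None\<close>; a representative \<open>f y\<close> with \<open>y \<in> C\<close> gets the
  color \<open>y\<close>; \<open>E\<close> colors the remaining vertices.\<close>

definition coloring :: "('a \<Rightarrow> 'a) \<Rightarrow> 'a set \<Rightarrow> 'a \<Rightarrow> ('a \<Rightarrow> 'a option) \<Rightarrow> 'a \<Rightarrow> 'a option" where
  "coloring f C e E w =
     (if w \<in> X then if w = e then None else Some w
      else if w \<in> f ` C then Some (inv_into C f w) else E w)"

text \<open>For \<open>j \<in> C\<close>, the equation \<open>f x = f j\<close> means that the
  representative of \<open>x\<close> has color \<open>j\<close>, so a free neighbor of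
  \<open>x\<close> must avoid \<open>j\<close>. The second clause concerns free vertices only, as
  representatives are satisfied by their own color.\<close>

definition admissible :: "('a \<Rightarrow> 'a) \<Rightarrow> 'a set \<Rightarrow> 'a \<Rightarrow> 'a set \<Rightarrow> ('a \<Rightarrow> 'a option) \<Rightarrow> bool" where
  "admissible f C e K E \<longleftrightarrow>
     (\<forall>u\<in>free f C K. \<forall>j. E u = Some j \<longrightarrow>
        j \<in> X \<and> j \<notin> colors f C K \<and> (\<forall>x\<in>S u. j \<in> C \<longrightarrow> f x \<noteq> f j)) \<and>
     (\<forall>u\<in>free f C K. \<exists>i. \<exists>!w. w \<in> (K - {u}) \<union> S u \<and> coloring f C e E w = i)"

section \<open>Colorings from a choice of representatives\<close>

lemma choiceD:
  assumes "choice f C e"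
  shows "x \<in> X \<Longrightarrow> f x \<in> \<Union>P" "x \<in> X \<Longrightarrow> x \<in> S (f x)" "x \<in> X \<Longrightarrow> f x \<notin> X"
    "C \<subseteq> X" "inj_on f C" "f ` C = f ` X" "e \<in> X" "e \<notin> C"
  using assms outside_X by (auto simp: choice_def)

lemma coloring_X: "w \<in> X \<Longrightarrow> coloring f C e E w = (if w = e then None else Some w)"
  by (simp add: coloring_def)

lemma coloring_rep:
  assumes "choice f C e" "y \<in> C"
  shows "coloring f C e E (f y) = Some y"
proof -
  have "y \<in> X" using choiceD(4)[OF assms(1)] assms(2) by blast
  then have "f y \<notin> X" using choiceD(3)[OF assms(1)] by blast
  then show ?thesis
    using assms choiceD(5)[OF assms(1)] by (simp add: coloring_def)
qed

lemma coloring_free: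
  assumes "K \<in> P" "w \<in> free f C K"
  shows "coloring f C e E w = E w"
  using assms outside_X by (auto simp: coloring_def free_def)

lemma clique_cases:
  assumes "choice f C e" "w \<in> K"
  obtains y where "y \<in> colors f C K" "w = f y" | "w \<in> free f C K"
  using assms by (auto simp: colors_def free_def)

text \<open>Each \<open>x \<in> X\<close> sees the color of its representative once: other
  representatives have other colors, and free neighbors avoid it. A representative
  \<open>f y\<close> sees color \<open>y\<close> only at \<open>y\<close>, because free vertices of
  its clique avoid \<open>y\<close>.\<close>

lemma conflict_freeI:
  assumes ch: "choice f C e" and E: "\<And>K. K \<in> P \<Longrightarrow> admissible f C e K E"
  shows "conflict_free (coloring f C e E)"
  unfolding conflict_free_def
proof (intro conjI ballI)
  let ?D = "coloring f C e E"
  note c = choiceD[OF ch]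
  show "?D ` (X \<union> \<Union>P) \<subseteq> insert None (Some ` X)"
  proof (rule image_subsetI)
    fix w assume w: "w \<in> X \<union> \<Union>P"
    show "?D w \<in> insert None (Some ` X)"
    proof (cases "w \<in> X")
      case True then show ?thesis by (simp add: coloring_X)
    next
      case False
      then obtain K where K: "K \<in> P" "w \<in> K" using w by blast
      from ch K(2) show ?thesis
      proof (cases rule: clique_cases)
        case (1 y)
        then show ?thesis using c(4) coloring_rep[OF ch] by (auto simp: colors_def)
      next
        case 2
        then have "?D w = E w" using coloring_free K by blast
        then show ?thesis using 2 E[OF K(1)] unfolding admissible_def by (cases "E w") auto
      qed
    qed
  qed
  show "\<exists>i. \<exists>!w. w \<in> \<Union>P \<and> x \<in> S w \<and> ?D w = i" if x: "x \<in> X" for x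
  proof -
    obtain y where y: "y \<in> C" "f y = f x" using c(6) x by (metis imageE imageI)
    have "w = f x" if w: "w \<in> \<Union>P" "x \<in> S w" "?D w = Some y" for w
    proof -
      obtain K where K: "K \<in> P" "w \<in> K" using w by blast
      from ch K(2) show ?thesis
      proof (cases rule: clique_cases)
        case (1 z)
        then have "z = y" using coloring_rep[OF ch] w(3) by (auto simp: colors_def)
        then show ?thesis using 1 y by simp
      next
        case 2
        then have "E w = Some y" using coloring_free K w(3) by metis
        then show ?thesis using 2 E[OF K(1)] y w(2) unfolding admissible_def by metis
      qed
    qed
    then show ?thesis using c(1,2)[OF x] coloring_rep[OF ch y(1)] y(2) by metis
  qed
  show "\<exists>i. \<exists>!w. w \<in> (K - {v}) \<union> S v \<and> ?D w = i" if K: "K \<in> P" "v \<in> K" for K v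
    using ch K(2)
  proof (cases rule: clique_cases)
    case (1 y)
    then have yC: "y \<in> C" "y \<in> X" "y \<noteq> e" using c(4,8) by (auto simp: colors_def)
    have "w = y" if w: "w \<in> (K - {v}) \<union> S v" "?D w = Some y" for w
    proof (cases "w \<in> X")
      case True
      then show ?thesis using w(2) by (auto simp: coloring_X split: if_splits)
    next
      case False
      then have "w \<in> K" "w \<noteq> v" using w(1) S_subset by auto
      from ch this(1) show ?thesis
      proof (cases rule: clique_cases)
        case (1 z)
        then have "z = y" using coloring_rep[OF ch] w(2) by (auto simp: colors_def)
        then show ?thesis using 1 \<open>v = f y\<close> \<open>w \<noteq> v\<close> by simp
      next
        case 2
        then have "E w = Some y" using coloring_free K(1) w(2) by metis
        then show ?thesis using 2 E[OF K(1)] \<open>y \<in> colors f C K\<close> unfolding admissible_def by blast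
      qed
    qed
    moreover have "y \<in> S v" using 1 c(2) yC by auto
    moreover have "?D y = Some y" using yC by (simp add: coloring_X)
    ultimately show ?thesis by (intro unique_colorI[of y _ _ "Some y"]) auto
  next
    case 2
    then show ?thesis using E[OF K(1)] unfolding admissible_def by blast
  qed
qed

lemma admissible_cong:
  assumes "admissible f C e K E'" "\<And>w. w \<in> K \<Longrightarrow> E w = E' w"
  shows "admissible f C e K E"
proof -
  have E: "E u = E' u" if "u \<in> free f C K" for u
    using that assms(2) by (auto simp: free_def)
  have "coloring f C e E w = coloring f C e E' w" if "w \<in> (K - {u}) \<union> S u" for u w
    using that assms(2) S_subset[of u] by (auto simp: coloring_def)
  then have "(w \<in> (K - {u}) \<union> S u \<and> coloring f C e E w = i) =
      (w \<in> (K - {u}) \<union> S u \<and> coloring f C e E' w = i)" for u w i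
    by metis
  then have "\<exists>i. \<exists>!w. w \<in> (K - {u}) \<union> S u \<and> coloring f C e E w = i" if "u \<in> free f C K" for u
    using assms(1) that unfolding admissible_def by (simp only:)
  then show ?thesis
    using assms(1) unfolding admissible_def by (simp add: E)
qed

text \<open>Color \<open>e\<close> on one free vertex \<open>u\<close> satisfies all other free
  vertices of \<open>K\<close>. For \<open>u\<close> itself, a fixable blocked clique offers
  \<open>j\<close> on \<open>v\<close>, and otherwise a difference between \<open>S u - {e}\<close>
  and the colors of \<open>K\<close> helps. If \<open>u\<close> is the only free vertex and
  \<open>e \<in> S u\<close>, it may stay neutral.\<close>

lemma exists_admissible:
  assumes ch: "choice f C e" and K: "K \<in> P" and ok: "blocked f C e K \<longrightarrow> fixable f C e K"
  shows "\<exists>E. admissible f C e K E"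
proof -
  note c = choiceD[OF ch]
  have D_free: "coloring f C e E w = E w" if "w \<in> free f C K" for w E
    using coloring_free K that by blast
  have e_C: "e \<notin> colors f C K" using c(8) by (simp add: colors_def)
  \<comment> \<open>Color \<open>e\<close> occurs neither in \<open>X\<close>, where
    \<open>e\<close> itself is neutral, nor on representatives, since
    \<open>e \<notin> C\<close>.\<close>
  have e_unique: "\<exists>i. \<exists>!w. w \<in> (K - {v}) \<union> S v \<and> coloring f C e E w = i"
    if u: "u \<in> free f C K" "v \<noteq> u" and E: "E u = Some e" "\<And>w. w \<noteq> u \<Longrightarrow> E w \<noteq> Some e" for u v E
  proof -
    have "w = u" if w: "w \<in> (K - {v}) \<union> S v" "coloring f C e E w = Some e" for w
    proof (cases "w \<in> X")
      case True then show ?thesis using w by (auto simp: coloring_X split: if_splits)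
    next
      case False
      then have "w \<in> K" using w(1) S_subset by auto
      from ch this show ?thesis
      proof (cases rule: clique_cases)
        case (1 y)
        then show ?thesis using w(2) coloring_rep[OF ch] e_C by (auto simp: colors_def)
      next
        case 2
        then show ?thesis using w(2) D_free E(2) by metis
      qed
    qed
    moreover have "u \<in> K" using u(1) by (simp add: free_def)
    ultimately show ?thesis using u D_free[OF u(1)] E(1) by (intro unique_colorI[of u _ _ "Some e"]) auto
  qed
  show ?thesis
  proof (cases "blocked f C e K")
    case True
    then obtain u v j where uv: "u \<in> free f C K" "v \<in> free f C K" "j \<in> X" "u \<noteq> v" "j \<noteq> e"
      "j \<notin> colors f C K" "j \<notin> S u" "\<forall>x\<in>S v. j \<in> C \<longrightarrow> f x \<noteq> f j"
      using ok unfolding fixable_def by blast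
    define E where "E = (\<lambda>w. if w = u then Some e else if w = v then Some j else None)"
    have "w = v" if w: "w \<in> (K - {u}) \<union> S u" "coloring f C e E w = Some j" for w
    proof (cases "w \<in> X")
      case True then show ?thesis using w uv(7) outside_X K by (auto simp: coloring_X split: if_splits)
    next
      case False
      then have "w \<in> K" "w \<noteq> u" using w(1) S_subset by auto
      from ch this(1) show ?thesis
      proof (cases rule: clique_cases)
        case (1 y)
        then show ?thesis using w(2) coloring_rep[OF ch] uv(6) by (auto simp: colors_def)
      next
        case 2
        then show ?thesis using w(2) D_free \<open>w \<noteq> u\<close> by (auto simp: E_def split: if_splits)
      qed
    qed
    moreover have "v \<in> K" using uv(2) by (simp add: free_def)
    ultimately have "\<exists>i. \<exists>!w. w \<in> (K - {u}) \<union> S u \<and> coloring f C e E w = i"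
      using D_free[OF uv(2), of E] uv(4) by (intro unique_colorI[of v _ _ "Some j"]) (auto simp: E_def)
    moreover have "\<exists>i. \<exists>!w. w \<in> (K - {x}) \<union> S x \<and> coloring f C e E w = i" if "x \<noteq> u" for x
      by (rule e_unique[OF uv(1) that]) (use uv in \<open>auto simp: E_def\<close>)
    ultimately have "\<forall>x\<in>free f C K. \<exists>i. \<exists>!w. w \<in> (K - {x}) \<union> S x \<and> coloring f C e E w = i"
      by metis
    then have "admissible f C e K E"
      unfolding admissible_def using uv c(7,8) e_C by (auto simp: E_def)
    then show ?thesis by (rule exI[of _ E])
  next
    case False
    then consider "free f C K = {}"
      | u where "u \<in> free f C K" "S u - {e} \<noteq> colors f C K"
      | u where "free f C K = {u}" "e \<in> S u"
      unfolding blocked_def by blast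
    then show ?thesis
    proof cases
      case 1 then show ?thesis by (auto simp: admissible_def)
    next
      case (2 u)
      define E where "E = (\<lambda>w. if w = u then Some e else None)"
      have "\<exists>i. \<exists>!w. w \<in> (K - {u}) \<union> S u \<and> coloring f C e E w = i"
      \<comment> \<open>What \<open>u\<close> sees exactly once is either an
        \<open>a \<in> S u\<close> whose color no representative in \<open>K\<close> has, or a
        representative in \<open>K\<close> whose color is not in \<open>S u\<close>.\<close>
      proof (cases "colors f C K \<subseteq> S u - {e}")
        case True
        then obtain a where a: "a \<in> S u" "a \<noteq> e" "a \<notin> colors f C K" using 2(2) by blast
        have "w = a" if w: "w \<in> (K - {u}) \<union> S u" "coloring f C e E w = Some a" for w
        proof (cases "w \<in> X")
          case True then show ?thesis using w by (auto simp: coloring_X split: if_splits)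
        next
          case False
          then have "w \<in> K" "w \<noteq> u" using w(1) S_subset by auto
          from ch this(1) show ?thesis
          proof (cases rule: clique_cases)
            case (1 y)
            then show ?thesis using w(2) coloring_rep[OF ch] a by (auto simp: colors_def)
          next
            case 2
            then show ?thesis using w(2) D_free \<open>w \<noteq> u\<close> by (auto simp: E_def split: if_splits)
          qed
        qed
        moreover have "coloring f C e E a = Some a" using a S_subset by (auto simp: coloring_def)
        ultimately show ?thesis using a(1) by (intro unique_colorI[of a _ _ "Some a"]) auto
      next
        case False
        then obtain a where a: "a \<in> colors f C K" "a \<notin> S u" using e_C by blast
        have "w = f a" if w: "w \<in> (K - {u}) \<union> S u" "coloring f C e E w = Some a" for w
        proof (cases "w \<in> X")
          case True then show ?thesis using w a outside_X K by (auto simp: coloring_X split: if_splits)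
        next
          case False
          then have "w \<in> K" "w \<noteq> u" using w(1) S_subset by auto
          from ch this(1) show ?thesis
          proof (cases rule: clique_cases)
            case (1 y)
            then show ?thesis using w(2) coloring_rep[OF ch] a by (auto simp: colors_def)
          next
            case 2
            then show ?thesis using w(2) D_free \<open>w \<noteq> u\<close> by (auto simp: E_def split: if_splits)
          qed
        qed
        moreover have "f a \<in> K - {u}" using a 2(1) by (auto simp: colors_def free_def)
        moreover have "coloring f C e E (f a) = Some a"
          using coloring_rep[OF ch] a by (simp add: colors_def)
        ultimately show ?thesis by (intro unique_colorI[of "f a" _ _ "Some a"]) auto
      qed
      moreover have "\<exists>i. \<exists>!w. w \<in> (K - {x}) \<union> S x \<and> coloring f C e E w = i" if "x \<noteq> u" for x
        by (rule e_unique[OF 2(1) that]) (auto simp: E_def)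
      ultimately have "\<forall>x\<in>free f C K. \<exists>i. \<exists>!w. w \<in> (K - {x}) \<union> S x \<and> coloring f C e E w = i"
        by metis
      then have "admissible f C e K E"
        unfolding admissible_def using c(7,8) e_C by (auto simp: E_def)
      then show ?thesis by (rule exI[of _ E])
    next
      case (3 u)
      define E :: "'a \<Rightarrow> 'a option" where "E = (\<lambda>w. None)"
      \<comment> \<open>The other vertices of \<open>K\<close> are representatives and thus not
        neutral.\<close>
      have "w = e" if w: "w \<in> (K - {u}) \<union> S u" "coloring f C e E w = None" for w
      proof (cases "w \<in> X")
        case True then show ?thesis using w by (auto simp: coloring_X split: if_splits)
      next
        case False
        then have "w \<in> K" "w \<noteq> u" using w(1) S_subset by auto
        from ch this(1) show ?thesis
        proof (cases rule: clique_cases)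
          case (1 y)
          then show ?thesis using w(2) coloring_rep[OF ch] by (auto simp: colors_def)
        next
          case 2
          then show ?thesis using \<open>w \<noteq> u\<close> 3 by auto
        qed
      qed
      moreover have "coloring f C e E e = None" using c(7) by (simp add: coloring_def)
      ultimately have "\<exists>i. \<exists>!w. w \<in> (K - {u}) \<union> S u \<and> coloring f C e E w = i"
        using 3(2) by (intro unique_colorI[of e _ _ None]) auto
      then have "admissible f C e K E"
        unfolding admissible_def using 3(1) by (simp add: E_def)
      then show ?thesis by (rule exI[of _ E])
    qed
  qed
qed

text \<open>Admissibility for \<open>K\<close> depends only on the values on \<open>K\<close>, so
  the colorings found for the separate cliques can be glued.\<close>

lemma exists_conflict_free:
  assumes ch: "choice f C e" and ok: "\<And>K. \<lbrakk>K \<in> P; blocked f C e K\<rbrakk> \<Longrightarrow> fixable f C e K"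
  shows "\<exists>D. conflict_free D"
proof -
  obtain F where F: "\<And>K. K \<in> P \<Longrightarrow> admissible f C e K (F K)"
    using exists_admissible[OF ch] ok by metis
  define E where "E = (\<lambda>w. F (THE K. K \<in> P \<and> w \<in> K) w)"
  have "E w = F K w" if "K \<in> P" "w \<in> K" for K w
  proof -
    have "(THE L. L \<in> P \<and> w \<in> L) = K"
      by (rule the_equality) (use that cliques_disjoint in blast)+
    then show ?thesis by (simp add: E_def)
  qed
  then have "admissible f C e K E" if "K \<in> P" for K
    using admissible_cong[of f C e K "F K" E] F that by blast
  then show ?thesis using conflict_freeI[OF ch] by blast
qed

section \<open>The case without branching vertices\<close>

lemma avoid_two: "\<exists>j\<in>X. j \<noteq> a \<and> j \<noteq> b"
proof (rule ccontr)
  assume "\<not> ?thesis"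
  then have "X \<subseteq> {a, b}" by blast
  then have "card X \<le> card {a, b}" by (intro card_mono) auto
  also have "\<dots> \<le> 2" by (simp add: card_insert_if)
  finally show False using card_X by simp
qed

lemma neighbor_in_cliques: "x \<in> X \<Longrightarrow> \<exists>w\<in>\<Union>P. x \<in> S w"
  using wide_neighbor by blast

lemma conflict_free_if_unbranched:
  assumes single: "\<And>w x y. \<lbrakk>w \<in> \<Union>P; x \<in> S w; y \<in> S w\<rbrakk> \<Longrightarrow> x = y"
  shows "\<exists>D. conflict_free D"
proof -
  obtain f where f: "\<And>x. x \<in> X \<Longrightarrow> f x \<in> \<Union>P" "\<And>x. x \<in> X \<Longrightarrow> x \<in> S (f x)"
    using neighbor_in_cliques by metis
  have inj: "inj_on f X"
    using f single by (intro inj_onI) metis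
  \<comment> \<open>\<open>u\<close> is to be the vertex of \<open>K\<close> touching
    \<open>X\<close> whose color \<open>i\<close> occurs once in \<open>K\<close>. If
    \<open>K\<close> contains representatives, \<open>u\<close> is one of them, as their colors are
    forced and distinct; otherwise \<open>i\<close> must not disturb the neighbor of
    \<open>u\<close>.\<close>
  define Q where "Q K u i \<longleftrightarrow> u \<in> K \<and> S u \<noteq> {} \<and> i \<in> X \<and> (\<forall>y\<in>X. f y \<in> K \<longrightarrow> u \<in> f ` X) \<and>
      (\<forall>y\<in>X. f y = u \<longrightarrow> i = y) \<and> (u \<notin> f ` X \<longrightarrow> i \<notin> S u)" for K u i
  have "\<exists>u i. Q K u i" if K: "K \<in> P" for K
  proof (cases "\<exists>y\<in>X. f y \<in> K")
    case True
    then obtain y where "y \<in> X" "f y \<in> K" by blast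
    then have "Q K (f y) y" using f inj unfolding Q_def by (auto simp: inj_on_eq_iff)
    then show ?thesis by blast
  next
    case False
    obtain u where u: "u \<in> K" "S u \<noteq> {}" using touching[OF K] by blast
    then obtain x where "x \<in> S u" by blast
    obtain i where "i \<in> X" "i \<noteq> x" using avoid_two by blast
    moreover have "i \<notin> S u" using single[of u x i] \<open>x \<in> S u\<close> \<open>i \<noteq> x\<close> u(1) K by blast
    ultimately have "Q K u i" using u False unfolding Q_def by blast
    then show ?thesis by blast
  qed
  then obtain u i where Q: "\<And>K. K \<in> P \<Longrightarrow> Q K (u K) (i K)" by metis
  have ui: "u K \<in> K" "S (u K) \<noteq> {}" "i K \<in> X"
    "\<And>y. \<lbrakk>y \<in> X; f y \<in> K\<rbrakk> \<Longrightarrow> u K \<in> f ` X" "\<And>y. \<lbrakk>y \<in> X; f y = u K\<rbrakk> \<Longrightarrow> i K = y"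
    "u K \<notin> f ` X \<Longrightarrow> i K \<notin> S (u K)" if "K \<in> P" for K
    using Q[OF that] unfolding Q_def by blast+
  define R where "R K w c \<longleftrightarrow> c \<in> X \<and> (\<forall>y\<in>X. w = f y \<longrightarrow> c = y) \<and> (w = u K \<longrightarrow> c = i K) \<and>
      (w \<notin> f ` X \<longrightarrow> c \<notin> S w) \<and> (w \<noteq> u K \<longrightarrow> c \<noteq> i K)" for K w c
  have "\<exists>c. R K w c" if K: "K \<in> P" "w \<in> K" for K w
  proof (cases "w \<in> f ` X")
    case True
    then obtain y where y: "y \<in> X" "w = f y" by blast
    have "i K \<noteq> y" if "w \<noteq> u K"
    proof -
      obtain z where "z \<in> X" "u K = f z" using ui(4)[OF K(1) y(1)] K(2) y(2) by blast
      then show ?thesis using ui(5)[OF K(1), of z] y(2) that by auto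
    qed
    moreover have "\<forall>z\<in>X. w = f z \<longrightarrow> y = z"
      using inj_onD[OF inj, of y] y by simp
    moreover have "w = u K \<longrightarrow> y = i K" using ui(5)[OF K(1) y(1)] y(2) by simp
    ultimately have "R K w y" using y(1) True unfolding R_def by auto
    then show ?thesis by blast
  next
    case False
    show ?thesis
    proof (cases "w = u K")
      case True
      then have "R K w (i K)" using ui(3,6)[OF K(1)] False unfolding R_def by auto
      then show ?thesis by blast
    next
      case neq: False
      have "\<exists>x. S w \<subseteq> {x}"
      proof (cases "S w = {}")
        case False
        then obtain x where "x \<in> S w" by blast
        then have "S w \<subseteq> {x}" using single[of w _ x] K by blast
        then show ?thesis ..
      qed simp
      then obtain x where x: "S w \<subseteq> {x}" ..
      \<comment> \<open>Three colors in \<open>X\<close> suffice to avoid both the neighbor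
        \<open>x\<close> of \<open>w\<close> and the color \<open>i K\<close> reserved for
        \<open>u K\<close>.\<close>
      obtain c where "c \<in> X" "c \<noteq> x" "c \<noteq> i K" using avoid_two by blast
      then have "R K w c" using x neq False unfolding R_def by auto
      then show ?thesis by blast
    qed
  qed
  then obtain c where R: "\<And>K w. \<lbrakk>K \<in> P; w \<in> K\<rbrakk> \<Longrightarrow> R K w (c K w)" by metis
  have c: "c K w \<in> X" "\<And>y. \<lbrakk>y \<in> X; w = f y\<rbrakk> \<Longrightarrow> c K w = y" "w = u K \<Longrightarrow> c K w = i K"
    "w \<notin> f ` X \<Longrightarrow> c K w \<notin> S w" "w \<noteq> u K \<Longrightarrow> c K w \<noteq> i K" if "K \<in> P" "w \<in> K" for K w
    using R[OF that] unfolding R_def by blast+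
  define D where "D = (\<lambda>w. if w \<in> X then None else Some (c (THE K. K \<in> P \<and> w \<in> K) w))"
  have D: "D w = Some (c K w)" if "K \<in> P" "w \<in> K" for K w
  proof -
    have "(THE L. L \<in> P \<and> w \<in> L) = K"
      by (rule the_equality) (use that cliques_disjoint in blast)+
    then show ?thesis using that outside_X by (auto simp: D_def)
  qed
  have D_X: "D x = None" if "x \<in> X" for x using that by (simp add: D_def)
  have "conflict_free D"
    unfolding conflict_free_def
  proof (intro conjI ballI)
    show "D ` (X \<union> \<Union>P) \<subseteq> insert None (Some ` X)"
      using D D_X c(1) by auto
    show "\<exists>i. \<exists>!w. w \<in> \<Union>P \<and> x \<in> S w \<and> D w = i" if x: "x \<in> X" for x
    proof -
      obtain K where K: "K \<in> P" "f x \<in> K" using f(1)[OF x] by blast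
      have "D (f x) = Some x" using D[OF K] c(2)[OF K x] by simp
      moreover have "w = f x" if w: "w \<in> \<Union>P" "x \<in> S w" "D w = Some x" for w
      proof -
        obtain L where L: "L \<in> P" "w \<in> L" using w(1) by blast
        then have cx: "c L w = x" using D w(3) by simp
        then obtain y where y: "w = f y" "y \<in> X" using c(4)[OF L] w(2) by blast
        then show ?thesis using c(2)[OF L y(2,1)] cx by simp
      qed
      ultimately show ?thesis using f x by metis
    qed
    show "\<exists>i. \<exists>!w. w \<in> (K - {v}) \<union> S v \<and> D w = i" if K: "K \<in> P" "v \<in> K" for K v
    proof (cases "S v = {}")
      case True
      have "w = u K" if "w \<in> (K - {v}) \<union> S v" "D w = Some (i K)" for w
        using that True D[OF K(1), of w] c(5)[OF K(1), of w] by auto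
      moreover have "u K \<noteq> v" using True ui(2) K(1) by blast
      moreover have "D (u K) = Some (i K)" using D c(3)[OF K(1)] ui(1)[OF K(1)] K(1) by simp
      ultimately show ?thesis using ui(1)[OF K(1)]
        by (intro unique_colorI[of "u K" _ _ "Some (i K)"]) auto
    next
      case False
      then obtain x where x: "x \<in> S v" by blast
      have "w = x" if w: "w \<in> (K - {v}) \<union> S v" "D w = None" for w
      proof -
        have "w \<notin> K" using D[OF K(1)] w(2) by auto
        then show ?thesis using w(1) x single[of v w x] K by blast
      qed
      then show ?thesis using x D_X[of x] S_subset
        by (intro unique_colorI[of x _ _ None]) auto
    qed
  qed
  then show ?thesis by blast
qed

section \<open>Configurations with representatives in wide cliques\<close>

text \<open>Representatives are taken from wide cliques, because a clique of two vertices which both have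
  \<open>x\<close> as their only neighbor in \<open>X\<close> cannot be repaired once
  it contains the representative of \<open>x\<close>.\<close>

definition wide :: "'a set \<Rightarrow> bool" where
  "wide K \<longleftrightarrow> (\<forall>x. \<exists>v\<in>K. \<not> S v \<subseteq> {x})"

lemma exists_wide_neighbor:
  assumes "x \<in> X"
  shows "\<exists>w. x \<in> S w \<and> (\<exists>K\<in>P. w \<in> K \<and> wide K)"
proof -
  obtain K w v where K: "K \<in> P" "w \<in> K" "x \<in> S w" "v \<in> K" "\<not> S v \<subseteq> {x}"
    using wide_neighbor[OF assms] by blast
  \<comment> \<open>For \<open>z \<noteq> x\<close> the vertex \<open>w\<close> itself is a witness,
    since \<open>x \<in> S w\<close>.\<close>
  have "\<exists>v\<in>K. \<not> S v \<subseteq> {z}" for z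
    by (cases "z = x") (use K in blast)+
  then show ?thesis using K unfolding wide_def by blast
qed

text \<open>The class over which the minima are taken. If \<open>e\<close> lies in
  \<open>S r\<close> and \<open>S r\<close> has another element, that element can stand for
  \<open>r\<close> in \<open>C\<close>, which leaves \<open>e\<close> spare.\<close>

definition config :: "'a \<Rightarrow> 'a \<Rightarrow> ('a \<Rightarrow> 'a) \<Rightarrow> 'a set \<Rightarrow> bool" where
  "config r e f C \<longleftrightarrow> choice f C e \<and> (\<forall>x\<in>X. \<exists>K\<in>P. f x \<in> K \<and> wide K) \<and> (\<forall>x\<in>S r. f x = r)"

lemma finite_P: "finite P"
  using finite_W by (rule finite_UnionD)

lemma free_alt: "free f C K = K - f ` colors f C K"
  by (auto simp: free_def colors_def)

lemma blocked_cong: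
  assumes "colors f' C' K = colors f C K" "\<And>x. x \<in> colors f C K \<Longrightarrow> f' x = f x"
  shows "blocked f' C' e K = blocked f C e K"
proof -
  have "f' ` colors f C K = f ` colors f C K"
    using assms(2) by (intro image_cong) auto
  then have "free f' C' K = free f C K" using assms(1) by (simp add: free_alt)
  then show ?thesis using assms(1) by (simp add: blocked_def)
qed

text \<open>Blockedness forces \<open>S u \<subseteq> {e}\<close> on all of \<open>K\<close>, and a
  vertex touching \<open>X\<close> cannot be alone in \<open>K\<close>. The color \<open>j\<close>
  for a second vertex only has to avoid \<open>e\<close> and the color of the representative of
  \<open>e\<close>.\<close>

lemma fixable_if_no_colors:
  assumes ch: "choice f C e" and K: "K \<in> P" "blocked f C e K" "colors f C K = {}"
  shows "fixable f C e K"
proof -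
  have free: "free f C K = K" using K(3) by (simp add: free_alt)
  have S: "S u \<subseteq> {e}" if "u \<in> K" for u
    using K that unfolding blocked_def free by auto
  obtain u where u: "u \<in> K" "e \<in> S u" using touching[OF K(1)] S by blast
  then obtain v where v: "v \<in> K" "v \<noteq> u" using K(2) unfolding blocked_def free by blast
  obtain a where a: "a \<in> C" "f a = f e"
    using choiceD(6,7)[OF ch] by (metis imageE imageI)
  obtain j where j: "j \<in> X" "j \<noteq> e" "j \<noteq> a" using avoid_two by blast
  have "f x \<noteq> f j" if "x \<in> S v" "j \<in> C" for x
    using that S[OF v(1)] a j inj_onD[OF choiceD(5)[OF ch], of j a] by auto
  then show ?thesis
    unfolding fixable_def free
    by (intro bexI[of _ u] bexI[of _ v] bexI[of _ j]) (use u(1) v j S[OF u(1)] K(3) in auto)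
qed

end

section \<open>Extremal configurations\<close>

text \<open>The configuration is minimal first in the number of representatives, then in the number
  of blocked cliques. Twins of maximal degree into \<open>X\<close>, if there are any, occur also at
  \<open>r\<close>; \<open>e_preferred\<close> excludes a clique of two vertices at \<open>r\<close>
  that could not be repaired.\<close>

locale extremal = clustered +
  fixes r e f C
  assumes r_max: "\<And>w. w \<in> \<Union>P \<Longrightarrow> card (S w) \<le> card (S r)"
    and r_branching: "2 \<le> card (S r)"
    and twin_preferred: "\<lbrakk>K \<in> P; v \<in> K; w \<in> K; v \<noteq> w; S v = S w; card (S v) = card (S r); L \<in> P; r \<in> L\<rbrakk>
      \<Longrightarrow> \<exists>t\<in>L. t \<noteq> r \<and> S t = S r"
    and e_in: "e \<in> S r"
    and e_preferred: "\<lbrakk>{r, u} \<in> P; u \<noteq> r\<rbrakk> \<Longrightarrow> S u \<noteq> S r - {e}"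
    and config: "config r e f C"
    and min_card: "config r e f' C' \<Longrightarrow> card C \<le> card C'"
    and min_blocked: "\<lbrakk>config r e f' C'; card C' = card C\<rbrakk> \<Longrightarrow>
      card {K \<in> P. blocked f C e K} \<le> card {K \<in> P. blocked f' C' e K}"
begin

lemma ch: "choice f C e" using config by (simp add: config_def)

lemmas c = choiceD[OF ch]

lemma f_r: "x \<in> S r \<Longrightarrow> f x = r" using config by (simp add: config_def)

lemma f_e: "f e = r" using f_r e_in .

lemma finite_C: "finite C" using c(4) finite_X finite_subset by blast

lemma colors_subset: "colors f C K \<subseteq> C" by (auto simp: colors_def)

lemma free_S: "\<lbrakk>blocked f C e K; u \<in> free f C K\<rbrakk> \<Longrightarrow> S u - {e} = colors f C K"
  by (simp add: blocked_def)

lemma wide_if_colors: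
  assumes "K \<in> P" "x \<in> colors f C K"
  shows "wide K"
proof -
  have "x \<in> X" "f x \<in> K" using assms c(4) by (auto simp: colors_def)
  then show ?thesis using config cliques_disjoint assms(1) unfolding config_def by metis
qed

text \<open>A configuration with no more representatives that differs only in \<open>K\<close> has
  the same blocked cliques elsewhere, so unblocking \<open>K\<close> would contradict
  minimality.\<close>

lemma still_blocked:
  assumes cfg: "config r e f' C'" "card C' \<le> card C" and K: "K \<in> P" "blocked f C e K"
    and others: "\<And>L. \<lbrakk>L \<in> P; L \<noteq> K\<rbrakk> \<Longrightarrow> colors f' C' L = colors f C L"
      "\<And>L x. \<lbrakk>L \<in> P; L \<noteq> K; x \<in> colors f C L\<rbrakk> \<Longrightarrow> f' x = f x"
  shows "blocked f' C' e K"
proof (rule ccontr)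
  assume "\<not> ?thesis"
  moreover have "blocked f' C' e L = blocked f C e L" if "L \<in> P" "L \<noteq> K" for L
    using others that by (intro blocked_cong) auto
  ultimately have "{K \<in> P. blocked f' C' e K} \<subseteq> {K \<in> P. blocked f C e K} - {K}" by blast
  then have "{K \<in> P. blocked f' C' e K} \<subset> {K \<in> P. blocked f C e K}" using K by blast
  then have "card {K \<in> P. blocked f' C' e K} < card {K \<in> P. blocked f C e K}"
    using finite_P by (intro psubset_card_mono) auto
  moreover have "card C' = card C" using min_card[OF cfg(1)] cfg(2) by simp
  ultimately show False using min_blocked[OF cfg(1)] by simp
qed

text \<open>Replacing \<open>x\<close> by another \<open>b\<close> in \<open>C\<close> recolors the
  representative but keeps the free vertices. As \<open>K\<close> stays blocked,
  \<open>S u - {e}\<close> for a free \<open>u\<close> would equal two different color sets.\<close>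

lemma fiber:
  assumes K: "K \<in> P" "blocked f C e K" and x: "x \<in> colors f C K" and b: "b \<in> X" "f b = f x"
  shows "b = x \<or> b = e"
proof (rule ccontr)
  assume neg: "\<not> ?thesis"
  have xC: "x \<in> C" "f x \<in> K" using x by (auto simp: colors_def)
  have bC: "b \<notin> C" using inj_onD[OF c(5), of b x] b neg xC by blast
  let ?C = "insert b (C - {x})"
  have img: "f ` ?C = f ` C"
  proof -
    have "f ` ?C = f ` insert x (C - {x})" using b by (simp only: image_insert)
    then show ?thesis using xC by (simp only: insert_Diff)
  qed
  have "inj_on f ?C"
    using c(5) b xC by (auto simp: inj_on_def)
  then have "choice f ?C e"
    unfolding choice_def img using c neg b(1) by blast
  then have cfg: "config r e f ?C"
    using config unfolding config_def by blast
  have card: "card ?C = card C"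
    using bC xC(1) finite_C card_Suc_Diff1[of C x] by simp
  have others: "colors f ?C L = colors f C L" if "L \<in> P" "L \<noteq> K" for L
  proof -
    have "f x \<notin> L" using cliques_disjoint that K(1) xC by blast
    then show ?thesis using b by (auto simp: colors_def)
  qed
  have bl: "blocked f ?C e K"
    by (rule still_blocked[OF cfg _ K others]) (use card in auto)
  then obtain u where "u \<in> free f ?C K" by (auto simp: blocked_def)
  moreover from this have "u \<in> free f C K" unfolding free_def img .
  ultimately have "colors f ?C K = colors f C K"
    using bl K(2) by (auto simp: blocked_def)
  moreover have "b \<in> colors f ?C K" using b xC by (simp add: colors_def)
  ultimately show False using bC by (simp add: colors_def)
qed

lemma preimage:
  assumes K: "K \<in> P" "blocked f C e K" and b: "b \<in> X" "f b \<in> K"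
  shows "b = e \<or> b \<in> colors f C K"
proof -
  obtain x where "x \<in> C" "f b = f x" using c(6) b(1) by (metis imageE imageI)
  moreover from this have "x \<in> colors f C K" using b by (simp add: colors_def)
  ultimately show ?thesis using fiber[OF K] b by blast
qed

text \<open>Otherwise a free vertex could replace all the representatives in \<open>K\<close>, contradicting the
  minimality of \<^term>\<open>card C\<close>.\<close>

lemma single_color:
  assumes K: "K \<in> P" "blocked f C e K" "r \<notin> K" and a: "a \<in> colors f C K"
  shows "colors f C K = {a}"
proof -
  let ?A = "colors f C K"
  obtain u where u: "u \<in> free f C K" using K(2) by (auto simp: blocked_def)
  have Su: "?A \<subseteq> S u" using free_S[OF K(2) u] by blast
  have uK: "u \<in> K" "u \<notin> f ` C" using u by (auto simp: free_def)
  \<comment> \<open>By blockedness \<open>u\<close> is adjacent to all of \<open>?A\<close>, so it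
    can represent all of it, with the single color \<open>a\<close>.\<close>
  let ?f = "\<lambda>x. if x \<in> ?A then u else f x" and ?C = "insert a (C - ?A)"
  have aC: "a \<in> C" using a by (simp add: colors_def)
  have fA: "x \<in> ?A" if "x \<in> X" "f x \<in> K" for x
    using preimage[OF K(1,2)] that f_e K(3) by metis
  have "inj_on ?f ?C"
  proof -
    have "inj_on ?f (C - ?A)"
      using c(5) by (auto simp: inj_on_def)
    moreover have "?f a \<notin> ?f ` (C - ?A - {a})" using a uK(2) by auto
    ultimately show ?thesis by (auto simp: inj_on_insert)
  qed
  moreover have "?f ` ?C = ?f ` X"
  proof
    show "?f ` ?C \<subseteq> ?f ` X" using c(4) aC by (intro image_mono) auto
    show "?f ` X \<subseteq> ?f ` ?C"
    proof (rule image_subsetI)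
      fix x assume x: "x \<in> X"
      show "?f x \<in> ?f ` ?C"
      proof (cases "x \<in> ?A")
        case True
        then have "?f x = ?f a" using a by simp
        then show ?thesis by blast
      next
        case False
        obtain y where y: "y \<in> C" "f x = f y" using c(6) x by (metis imageE imageI)
        have "f x \<notin> K" using fA[OF x] False by blast
        then have "y \<notin> ?A" using y by (simp add: colors_def)
        then have "?f x = ?f y" using False y by simp
        then show ?thesis using y(1) \<open>y \<notin> ?A\<close> by blast
      qed
    qed
  qed
  ultimately have "choice ?f ?C e"
    using c aC Su uK(1) K(1) unfolding choice_def by auto
  moreover have "\<exists>L\<in>P. ?f x \<in> L \<and> wide L" if "x \<in> X" for x
    using config wide_if_colors[OF K(1)] that K(1) uK(1) unfolding config_def by auto
  moreover have "x \<notin> ?A" if "x \<in> S r" for x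
    using f_r[OF that] K(3) by (auto simp: colors_def)
  ultimately have "config r e ?f ?C"
    using f_r unfolding config_def by auto
  then have "card C \<le> card ?C" by (rule min_card)
  also have "\<dots> = Suc (card (C - ?A))" using a finite_C by (simp add: colors_def)
  also have "card (C - ?A) = card C - card ?A"
    using finite_C colors_subset by (intro card_Diff_subset) (auto intro: finite_subset)
  finally have "card ?A \<le> Suc 0"
    using card_mono[OF finite_C colors_subset, of K] by linarith
  then show ?thesis
    using a finite_subset[OF colors_subset finite_C] by (auto simp: card_le_Suc0_iff_eq)
qed

text \<open>If \<open>f b\<close> represents only \<open>b\<close>, a free \<open>u\<close> can take
  its place, since blockedness gives \<open>b \<in> S u\<close>. As \<open>K\<close> stays blocked
  and \<open>f b\<close> becomes free, this yields information on \<open>S (f b)\<close>.\<close>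

lemma swap:
  assumes K: "K \<in> P" "blocked f C e K" and b: "b \<in> colors f C K" "f b \<noteq> r"
    and u: "u \<in> free f C K" and fib: "\<And>x. \<lbrakk>x \<in> X; f x = f b\<rbrakk> \<Longrightarrow> x = b"
  shows "blocked (f(b := u)) C e K" "free (f(b := u)) C K = insert (f b) (free f C K - {u})"
    "colors (f(b := u)) C K = colors f C K"
proof -
  let ?f = "f(b := u)"
  have bC: "b \<in> C" "f b \<in> K" using b by (auto simp: colors_def)
  have uK: "u \<in> K" "u \<notin> f ` C" using u by (auto simp: free_def)
  have bu: "b \<in> S u" using free_S[OF K(2) u] b(1) by blast
  have fib': "x = b" if "x \<in> C" "f x = f b" for x using fib that c(4) by blast
  have same: "colors ?f C L = colors f C L" if "L \<in> P" for L
  proof -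
    have "u \<in> L \<longleftrightarrow> f b \<in> L" using cliques_disjoint that K(1) uK(1) bC(2) by blast
    then show ?thesis by (auto simp: colors_def)
  qed
  have img: "?f ` Y = insert u (f ` (Y - {b}))" if "b \<in> Y" for Y
    using that by auto
  have rest: "f ` (C - {b}) = f ` (X - {b})"
  proof
    show "f ` (X - {b}) \<subseteq> f ` (C - {b})"
    proof (rule image_subsetI)
      fix x assume x: "x \<in> X - {b}"
      then obtain y where "y \<in> C" "f x = f y" using c(6) by (metis DiffD1 imageE imageI)
      moreover from this have "y \<noteq> b" using fib[of x] x by auto
      ultimately show "f x \<in> f ` (C - {b})" by blast
    qed
  qed (use c(4) in blast)
  have "inj_on ?f C"
    using c(5) uK(2) by (auto simp: inj_on_def)
  moreover have "?f ` C = ?f ` X" using img bC(1) c(4) rest by (metis subsetD)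
  ultimately have "choice ?f C e"
    using c bu uK(1) K(1) unfolding choice_def by auto
  moreover have "\<exists>L\<in>P. ?f x \<in> L \<and> wide L" if "x \<in> X" for x
    using config wide_if_colors[OF K(1) b(1)] that K(1) uK(1) unfolding config_def by auto
  moreover have "b \<notin> S r" using f_r b(2) by blast
  ultimately have cfg: "config r e ?f C"
    using f_r unfolding config_def by auto
  show "blocked ?f C e K"
  proof (rule still_blocked[OF cfg _ K])
    fix L x assume L: "L \<in> P" "L \<noteq> K" "x \<in> colors f C L"
    then have "x \<noteq> b" using cliques_disjoint[OF L(1) K(1)] bC(2) by (auto simp: colors_def)
    then show "?f x = f x" by simp
  qed (use same in auto)
  show "colors ?f C K = colors f C K" using same K(1) .
  have "f b \<notin> f ` (C - {b})" using fib' by (metis DiffD1 DiffD2 imageE singletonI)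
  moreover have "u \<noteq> f b" using uK(2) bC(1) by blast
  moreover have "f ` C = insert (f b) (f ` (C - {b}))" using bC(1) by blast
  ultimately show "free ?f C K = insert (f b) (free f C K - {u})"
    unfolding free_def img[OF bC(1)] using bC(2) by auto
qed

text \<open>With two free vertices, any color \<open>j\<close> other than \<open>a\<close> and
  \<open>e\<close> repairs \<open>K\<close> unless it is the color of \<open>r\<close>, the
  representative of \<open>e\<close>. If no \<open>j\<close> works, there is only one such
  \<open>j\<close>, and \<open>X\<close> has three elements.\<close>

lemma fixable_or_exceptional:
  assumes K: "K \<in> P" "blocked f C e K" "r \<notin> K" and a: "a \<in> colors f C K"
    and not_fixable: "\<not> fixable f C e K"
  obtains p u v where "X = {a, e, p}" "C = {a, p}" "a \<noteq> e" "p \<noteq> e" "f p = r"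
    "\<And>w. w \<in> free f C K \<Longrightarrow> S w = {a, e}" "u \<in> free f C K" "v \<in> free f C K" "u \<noteq> v"
proof -
  have A: "colors f C K = {a}" using single_color[OF K a] .
  have aC: "a \<in> C" "f a \<in> K" "a \<in> X" using a c(4) by (auto simp: colors_def)
  have S: "S w - {e} = {a}" if "w \<in> free f C K" for w using free_S[OF K(2) that] A by simp
  obtain u where u: "u \<in> free f C K" using K(2) by (auto simp: blocked_def)
  have "free f C K \<noteq> {u}"
  proof
    assume single: "free f C K = {u}"
    then have Su: "S u = {a}" using S[of u] K(2) unfolding blocked_def by blast
    have fib: "x = a" if "x \<in> X" "f x = f a" for x
      using fiber[OF K(1,2) a that] that f_e aC(2) K(3) by metis
    have "f a \<noteq> r" using aC(2) K(3) by blast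
    note sw = swap[OF K(1,2) a this u fib]
    \<comment> \<open>After the swap \<open>f a\<close> is the only free vertex, so both vertices of
      \<open>K\<close> have \<open>a\<close> as their only neighbor in \<open>X\<close>, and
      \<open>K\<close> is not wide.\<close>
    have "free (f(a := u)) C K = {f a}" using sw(2) single by simp
    then have "S (f a) = {a}" using sw(1,3) A unfolding blocked_def by blast
    moreover have "K = {f a, u}"
      using single A aC(2) by (auto simp: free_alt)
    ultimately show False using wide_if_colors[OF K(1) a] Su unfolding wide_def by blast
  qed
  then obtain v where v: "v \<in> free f C K" "u \<noteq> v" using u by blast
  have bad: "e \<in> S w \<and> j \<in> C \<and> f j = r"
    if w: "w \<in> free f C K" and j: "j \<in> X" "j \<noteq> a" "j \<noteq> e" for w j
  proof -
    obtain w' where w': "w' \<in> free f C K" "w' \<noteq> w" using u v by blast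
    have "j \<notin> S w'" using S[OF w'(1)] j by blast
    then obtain x where x: "x \<in> S w" "j \<in> C" "f x = f j"
      using not_fixable w w' j A unfolding fixable_def by blast
    have "x \<noteq> a" using x j inj_onD[OF c(5), of a j] aC by blast
    then have "x = e" using x S[OF w] by blast
    then show ?thesis using x f_e by simp
  qed
  obtain p where p: "p \<in> X" "p \<noteq> a" "p \<noteq> e" using avoid_two by blast
  have pC: "p \<in> C" "f p = r" using bad[OF u p] by auto
  have "j = p" if j: "j \<in> X" "j \<noteq> a" "j \<noteq> e" for j
    using bad[OF u j] pC inj_onD[OF c(5), of j p] by simp
  then have X: "X = {a, e, p}" using p aC c(7) by blast
  then have "C = {a, p}" using c(4,8) aC pC by blast
  moreover have "S w = {a, e}" if "w \<in> free f C K" for w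
    using bad[OF that p] S[OF that] by blast
  moreover have "a \<noteq> e" using c(8) aC by blast
  ultimately show thesis using that X p(3) pC(2) u v by blast
qed

text \<open>If \<open>k\<close> is the color of \<open>r\<close>, then \<open>S r = {k, e}\<close>,
  so the maximal degree into \<open>X\<close> is two. This and the preference for twins leave
  \<open>k\<close> as the only color in \<open>K\<close>; the choice of \<open>e\<close> excludes a
  single free vertex, and with two of them any third color works.\<close>

lemma fixable_at_r:
  assumes K: "K \<in> P" "blocked f C e K" "r \<in> K"
  shows "fixable f C e K"
proof -
  obtain k where k: "k \<in> C" "f k = r" using c(6,7) f_e by (metis imageE imageI)
  have kA: "k \<in> colors f C K" using k K(3) by (simp add: colors_def)
  have ke: "k \<noteq> e" using c(8) k by blast
  have r_fib: "x = k \<or> x = e" if "x \<in> X" "f x = r" for x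
    using fiber[OF K(1,2) kA] that k by simp
  have Sr: "S r = {k, e}"
    using r_fib f_r S_subset e_in k c(2)[of k] c(4) by blast
  then have card_le: "card (S w) \<le> 2" if "w \<in> K" for w
  proof -
    have "w \<in> \<Union>P" using that K(1) by blast
    then have "card (S w) \<le> card {k, e}" using r_max Sr by metis
    then show ?thesis using ke by simp
  qed
  have eq: "S w = {k, b}" if "w \<in> K" "{k, b} \<subseteq> S w" "k \<noteq> b" for w b
    using card_seteq[of "S w" "{k, b}"] that card_le[OF that(1)] S_subset[of w] finite_X
    by (metis card_2_iff finite_subset)
  have A: "colors f C K = {k}"
  proof (rule ccontr)
    assume "\<not> ?thesis"
    then obtain b where b: "b \<in> colors f C K" "b \<noteq> k" using kA by blast
    have bC: "b \<in> C" "f b \<in> K" "b \<noteq> e" "b \<in> X" using b c(4,8) by (auto simp: colors_def)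
    have fb: "f b \<noteq> r" using inj_onD[OF c(5), of b k] k b bC by auto
    have fib: "x = b" if "x \<in> X" "f x = f b" for x
      using fiber[OF K(1,2) b(1) that] that(2) f_e fb by auto
    obtain u where u: "u \<in> free f C K" using K(2) by (auto simp: blocked_def)
    have S_free: "S w = {k, b}" if "w \<in> free f C K" for w
      using eq[of w b] free_S[OF K(2) that] b kA that by (auto simp: free_def)
    have A: "colors f C K = {k, b}" using free_S[OF K(2) u] S_free[OF u] ke bC(3) by blast
    \<comment> \<open>A twin of \<open>r\<close> could be neither free, as free vertices have
      neighbors \<open>k\<close> and \<open>b\<close>, nor the representative \<open>f b\<close>, as
      it is not adjacent to \<open>b\<close>.\<close>
    have no_twin: "\<not> (\<exists>t\<in>K. t \<noteq> r \<and> S t = S r)"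
    proof
      assume "\<exists>t\<in>K. t \<noteq> r \<and> S t = S r"
      then obtain t where t: "t \<in> K" "t \<noteq> r" "S t = {k, e}" using Sr by blast
      from ch t(1) show False
      proof (cases rule: clique_cases)
        case (1 y)
        then have "y = b" using A t(2) k(2) by auto
        then have "b \<in> S t" using 1 c(2)[OF bC(4)] by simp
        then show False using t(3) b(2) bC(3) by simp
      next
        case 2
        then show False using S_free t(3) bC(3) b(2) by blast
      qed
    qed
    \<comment> \<open>The swap shows that \<open>f b\<close> and \<open>u\<close> are twins of
      maximal degree, so \<open>r\<close> should have a twin in \<open>K\<close>.\<close>
    note sw = swap[OF K(1,2) b(1) fb u fib]
    have "f b \<in> free (f(b := u)) C K" using sw(2) by blast
    then have "S (f b) - {e} = {k, b}" using sw(1,3) A unfolding blocked_def by blast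
    then have "S (f b) = {k, b}" using eq[of "f b" b] bC(2) b(2) by blast
    moreover have "f b \<noteq> u" using u bC(1) by (auto simp: free_def)
    moreover have "card {k, b} = card (S r)" using Sr b(2) ke by simp
    ultimately have "\<exists>t\<in>K. t \<noteq> r \<and> S t = S r"
      using twin_preferred[of K "f b" u K] S_free[OF u] u bC(2) K(1,3) by (simp add: free_def)
    then show False using no_twin by blast
  qed
  obtain u where u: "u \<in> free f C K" using K(2) by (auto simp: blocked_def)
  have "free f C K \<noteq> {u}"
  proof
    assume single: "free f C K = {u}"
    then have "S u = {k}" using free_S[OF K(2) u] A K(2) unfolding blocked_def by blast
    moreover have "K = {r, u}" using single A K(3) k(2) by (auto simp: free_alt)
    moreover have "u \<noteq> r" using u k by (auto simp: free_def)
    ultimately show False using e_preferred[of u] K(1) Sr ke by auto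
  qed
  then obtain v where v: "v \<in> free f C K" "u \<noteq> v" using u by blast
  obtain j where j: "j \<in> X" "j \<noteq> k" "j \<noteq> e" using avoid_two by blast
  have "f x \<noteq> f j" if "x \<in> S v" for x
  proof -
    have "x = k \<or> x = e" using free_S[OF K(2) v(1)] A that by blast
    then have "f x = r" using k(2) f_e by blast
    then show ?thesis using r_fib[of j] j by metis
  qed
  moreover have "j \<notin> S u" using free_S[OF K(2) u] A j by blast
  ultimately show ?thesis
    unfolding fixable_def
    by (intro bexI[of _ u] bexI[of _ v] bexI[of _ j]) (use u v j A in auto)
qed

text \<open>Here \<open>X = {a, e, p}\<close>, and exchanging the roles of \<open>e\<close> and \<open>p\<close> helps: \<open>K\<close> is then no longer
  blocked, and since \<open>K\<close> contains twins, so does the clique of \<open>r\<close>.\<close>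

lemma conflict_free_exceptional:
  assumes K: "K \<in> P" "blocked f C e K" "r \<notin> K" and a: "a \<in> colors f C K"
    and not_fixable: "\<not> fixable f C e K"
  shows "\<exists>D. conflict_free D"
proof -
  obtain p u v where p: "X = {a, e, p}" "C = {a, p}" "a \<noteq> e" "p \<noteq> e" "f p = r"
    and S: "\<And>w. w \<in> free f C K \<Longrightarrow> S w = {a, e}" and uv: "u \<in> free f C K" "v \<in> free f C K" "u \<noteq> v"
    using fixable_or_exceptional[OF assms] by metis
  have fa: "f a \<in> K" "f a \<noteq> r" using a K(3) by (auto simp: colors_def)
  then have ap: "a \<noteq> p" using p(5) by blast
  \<comment> \<open>The representatives stay the same, but \<open>r\<close> now has color
    \<open>e\<close>, and \<open>p\<close> becomes the neutral vertex.\<close>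
  have img: "f ` {a, e} = f ` C" using p(2,5) f_e by auto
  have "choice f {a, e} p"
    using ch p ap fa f_e img unfolding choice_def by auto
  moreover have "S r \<subseteq> {e, p}" using S_subset[of r] f_r p(1) fa(2) by blast
  then have "S r = {e, p}" using r_branching card_seteq[of "{e, p}" "S r"] p(4) by auto
  moreover have "fixable f {a, e} p L" if L: "L \<in> P" "blocked f {a, e} p L" for L
  proof (cases "colors f {a, e} L = {}")
    case True
    then show ?thesis using fixable_if_no_colors[OF \<open>choice f {a, e} p\<close> L] by blast
  next
    case False
    have free: "free f {a, e} M = free f C M" for M by (simp only: free_def img)
    have "L \<noteq> K"
    proof
      assume "L = K"
      then have "S u - {p} = colors f {a, e} K"
        using L(2) uv(1) unfolding blocked_def free by blast
      moreover have "e \<notin> colors f {a, e} K" using f_e K(3) by (simp add: colors_def)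
      ultimately show False using S[OF uv(1)] p(4) by auto
    qed
    then have "f a \<notin> L" using cliques_disjoint[OF L(1) K(1)] fa(1) by blast
    then have A: "colors f {a, e} L = {e}" and rL: "r \<in> L" using False f_e by (auto simp: colors_def)
    have S_L: "S w - {p} = {e}" if "w \<in> free f C L" for w
      using L(2) that unfolding blocked_def free A by blast
    \<comment> \<open>The twins \<open>u\<close> and \<open>v\<close> of \<open>K\<close> force a
      twin \<open>t\<close> of \<open>r\<close> in \<open>L\<close>. It is free, and
      \<open>p \<in> S t\<close> shows that it is not the only free vertex, so color
      \<open>a\<close> can go to another one.\<close>
    have "card (S u) = card (S r)" using S[OF uv(1)] \<open>S r = {e, p}\<close> p(3,4) by simp
    then obtain t where t: "t \<in> L" "t \<noteq> r" "S t = S r"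
      using twin_preferred[of K u v L] S uv K(1) L(1) rL by (auto simp: free_def)
    have tf: "t \<in> free f C L" using t f_e \<open>f a \<notin> L\<close> unfolding free[symmetric] by (auto simp: free_def)
    then have "free f C L \<noteq> {t}" using L(2) t(3) \<open>S r = {e, p}\<close> unfolding blocked_def free by blast
    then obtain w where w: "w \<in> free f C L" "w \<noteq> t" using tf by blast
    have "f x \<noteq> f a" if "x \<in> S w" for x
    proof -
      have "x = e \<or> x = p" using S_L[OF w(1)] that by blast
      then show ?thesis using f_e p(5) fa(2) by metis
    qed
    moreover have "a \<notin> S t" using S_L[OF tf] ap p(3) by blast
    ultimately show ?thesis
      unfolding fixable_def free A
      by (intro bexI[of _ t] bexI[of _ w] bexI[of _ a]) (use tf w p(1,3) ap in auto)
  qed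
  ultimately show ?thesis using exists_conflict_free by blast
qed

lemma conflict_free_extremal: "\<exists>D. conflict_free D"
proof (cases "\<forall>K\<in>P. blocked f C e K \<longrightarrow> fixable f C e K")
  case True
  then show ?thesis using exists_conflict_free[OF ch] by blast
next
  case False
  then obtain K where K: "K \<in> P" "blocked f C e K" "\<not> fixable f C e K" by blast
  then have "r \<notin> K" "colors f C K \<noteq> {}"
    using fixable_at_r fixable_if_no_colors[OF ch] by blast+
  then show ?thesis using conflict_free_exceptional K by blast
qed

end

section \<open>Existence of extremal configurations\<close>

context clustered
begin

lemma exists_config:
  assumes r: "r \<in> \<Union>P" "2 \<le> card (S r)" and e: "e \<in> S r"
  shows "\<exists>f C. config r e f C"
proof -
  obtain g where g: "\<And>x. x \<in> X \<Longrightarrow> x \<in> S (g x)" "\<And>x. x \<in> X \<Longrightarrow> \<exists>K\<in>P. g x \<in> K \<and> wide K"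
    using exists_wide_neighbor by metis
  define f where "f x = (if x \<in> S r then r else g x)" for x
  obtain k where k: "k \<in> S r" "k \<noteq> e"
    using r(2) e by (metis card_le_Suc0_iff_eq card.infinite not_less_eq_eq numeral_2_eq_2 zero_le)
  obtain L where L: "L \<in> P" "r \<in> L" using r(1) by blast
  have "\<exists>v\<in>L. \<not> S v \<subseteq> {x}" for x using k e L(2) by blast
  then have "wide L" by (simp add: wide_def)
  then have wide: "\<exists>K\<in>P. f x \<in> K \<and> wide K" if "x \<in> X" for x
    using g(2)[OF that] L by (auto simp: f_def)
  have "f e = f k" using e k by (simp add: f_def)
  moreover have "k \<in> X" "e \<in> X" using e k S_subset by blast+
  \<comment> \<open>Dropping \<open>e\<close> loses no representative, because \<open>k\<close>
    shares the representative \<open>r\<close> with it.\<close>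
  ultimately have "f ` X \<subseteq> f ` (X - {e})" using k(2) by (metis DiffI image_eqI image_subsetI singletonD)
  then obtain C where C: "C \<subseteq> X - {e}" "inj_on f C" "f ` X = f ` C"
    using subset_image_inj by metis
  have "choice f C e"
    unfolding choice_def
  proof (intro conjI ballI)
    show "f x \<in> \<Union>P" "x \<in> S (f x)" if "x \<in> X" for x
      using wide[OF that] g(1)[OF that] by (auto simp: f_def)
  qed (use C \<open>e \<in> X\<close> in auto)
  then have "config r e f C" using wide by (simp add: config_def f_def)
  then show ?thesis by blast
qed

lemma exists_conflict_free_coloring: "\<exists>D. conflict_free D"
proof (cases "\<forall>w\<in>\<Union>P. card (S w) \<le> 1")
  case True
  have "x = y" if "w \<in> \<Union>P" "x \<in> S w" "y \<in> S w" for w x y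
    using True that finite_subset[OF S_subset finite_X] by (metis One_nat_def card_le_Suc0_iff_eq)
  then show ?thesis by (rule conflict_free_if_unbranched)
next
  case False
  define m where "m = Max ((\<lambda>w. card (S w)) ` \<Union>P)"
  have le_m: "card (S w) \<le> m" if "w \<in> \<Union>P" for w
    unfolding m_def using that finite_W by (intro Max_ge) auto
  then have m2: "2 \<le> m" using False by fastforce
  have "m \<in> (\<lambda>w. card (S w)) ` \<Union>P"
    unfolding m_def using False finite_W by (intro Max_in) auto
  then obtain r0 where r0: "r0 \<in> \<Union>P" "card (S r0) = m" by blast
  let ?twins = "\<lambda>K v w. K \<in> P \<and> v \<in> K \<and> w \<in> K \<and> v \<noteq> w \<and> S v = S w \<and> card (S v) = m"
  \<comment> \<open>If there are twins of maximal degree, \<open>r\<close> is taken to be one of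
    them.\<close>
  obtain r where r: "r \<in> \<Union>P" "card (S r) = m"
    and twin: "\<And>K v w. ?twins K v w \<Longrightarrow> \<exists>L t. ?twins L r t"
  proof (cases "\<exists>K v w. ?twins K v w")
    case True
    then obtain K v w where "?twins K v w" by blast
    then show thesis using that[of v] by blast
  next
    case False
    then show thesis using that[of r0] r0 by blast
  qed
  obtain e1 e2 where e12: "e1 \<in> S r" "e2 \<in> S r" "e1 \<noteq> e2"
    using r(2) m2 by (metis card_le_Suc0_iff_eq card.infinite not_less_eq_eq numeral_2_eq_2 zero_le)
  \<comment> \<open>The clique of \<open>r\<close> contains at most one candidate \<open>u\<close>,
    and \<open>S u\<close> cannot equal both \<open>S r - {e1}\<close> and
    \<open>S r - {e2}\<close>.\<close>
  have "\<exists>e\<in>S r. \<forall>u. {r, u} \<in> P \<and> u \<noteq> r \<longrightarrow> S u \<noteq> S r - {e}"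
  proof (rule ccontr)
    assume neg: "\<not> ?thesis"
    then obtain u1 u2 where u: "{r, u1} \<in> P" "u1 \<noteq> r" "S u1 = S r - {e1}"
      "{r, u2} \<in> P" "u2 \<noteq> r" "S u2 = S r - {e2}"
      using e12 by metis
    then have "u1 = u2" using cliques_disjoint[of "{r, u1}" "{r, u2}" r] by (auto simp: doubleton_eq_iff)
    then show False using u e12 by blast
  qed
  then obtain e where e: "e \<in> S r" "\<And>u. \<lbrakk>{r, u} \<in> P; u \<noteq> r\<rbrakk> \<Longrightarrow> S u \<noteq> S r - {e}" by blast
  let ?cfg = "\<lambda>(f, C). config r e f C"
  obtain q where "?cfg q" using exists_config[OF r(1) _ e(1)] r(2) m2 by auto
  then obtain q1 where q1: "?cfg q1" "\<And>q. ?cfg q \<Longrightarrow> card (snd q1) \<le> card (snd q)"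
    using ex_has_least_nat[of ?cfg q "\<lambda>q. card (snd q)"] by blast
  let ?bl = "\<lambda>q. card {K \<in> P. blocked (fst q) (snd q) e K}"
  obtain q2 where q2: "?cfg q2" "card (snd q2) = card (snd q1)"
    "\<And>q. \<lbrakk>?cfg q; card (snd q) = card (snd q1)\<rbrakk> \<Longrightarrow> ?bl q2 \<le> ?bl q"
    using ex_has_least_nat[of "\<lambda>q. ?cfg q \<and> card (snd q) = card (snd q1)" q1 ?bl] q1(1) by blast
  obtain f C where fC: "q2 = (f, C)" by (cases q2)
  interpret extremal X P S r e f C
  proof
    show "\<exists>t\<in>L. t \<noteq> r \<and> S t = S r"
      if *: "K \<in> P" "v \<in> K" "w \<in> K" "v \<noteq> w" "S v = S w" "card (S v) = card (S r)" "L \<in> P" "r \<in> L"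
      for K v w L
    proof -
      obtain M t where M: "?twins M r t" using twin[of K v w] * r(2) by auto
      then have "M = L" using cliques_disjoint * by blast
      then show ?thesis using M by auto
    qed
    show "card C \<le> card C'" if "config r e f' C'" for f' C'
      using q1(2)[of "(f', C')"] q2(2) fC that by simp
    show "card {K \<in> P. blocked f C e K} \<le> card {K \<in> P. blocked f' C' e K}"
      if "config r e f' C'" "card C' = card C" for f' C'
      using q2(3)[of "(f', C')"] q2(2) fC that by simp
  qed (use r le_m m2 e q2(1) fC in auto)
  show ?thesis by (rule conflict_free_extremal)
qed

end

section \<open>Transfer to the graph\<close>

lemma chi_ON_le: "CFON_coloring G k C \<Longrightarrow> chi_ON G \<le> enat k"
  unfolding chi_ON_def by (rule INF_lower) blast

text \<open>Connectedness enters in this form. By symmetry, paths of the underlying undirected graph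
  are paths of \<open>G\<close>, along which one can induct.\<close>

lemma (in wf_digraph) connected_closed:
  assumes con: "connected G" and sym: "symmetric G"
    and Z: "Z \<subseteq> verts G" "Z \<noteq> {}" and closed: "\<And>u v. \<lbrakk>u \<in> Z; u \<rightarrow>\<^bsub>G\<^esub> v\<rbrakk> \<Longrightarrow> v \<in> Z"
  shows "Z = verts G"
proof
  obtain z where z: "z \<in> Z" using Z(2) by blast
  show "verts G \<subseteq> Z"
  proof
    fix v assume "v \<in> verts G"
    then have "z \<rightarrow>\<^sup>*\<^bsub>with_proj (mk_symmetric G)\<^esub> v"
      using con z Z(1) unfolding connected_def strongly_connected_def by auto
    then have "z \<rightarrow>\<^sup>*\<^bsub>G\<^esub> v" by (simp add: reachable_mk_symmetric_eq[OF sym])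
    then show "v \<in> Z"
      by (induct rule: reachable_induct) (use z closed in auto)
  qed
qed (rule Z(1))

theorem theorem5:
  fixes G :: "('a, 'b) pre_digraph" and X :: "'a set" and d :: nat
  assumes "graph G" and "connected G" and "card (verts G) \<ge> 2"
    and "X \<subseteq> verts G" and "card X = d" and "d \<ge> 3"
    and "disjoint_union_of_cliques (G \<restriction> (verts G - X))"
    and "independent_set G X"
  shows "chi_ON G \<le> enat (d + 1)"
proof -
  interpret graph G by (fact assms(1))
  let ?W = "verts G - X"
  let ?S = "\<lambda>w. {x \<in> X. w \<rightarrow>\<^bsub>G\<^esub> x}"
  note sym = sym_arcs
  have symD: "v \<rightarrow>\<^bsub>G\<^esub> u" if "u \<rightarrow>\<^bsub>G\<^esub> v" for u v
    using that sym by (auto simp: symmetric_def elim: symE)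
  have dom_sub: "u \<rightarrow>\<^bsub>G \<restriction> ?W\<^esub> v \<longleftrightarrow> u \<in> ?W \<and> v \<in> ?W \<and> u \<rightarrow>\<^bsub>G\<^esub> v" for u v
    by (auto simp: arcs_ends_conv)
  have vertsD: "u \<in> verts G" "v \<in> verts G" "u \<noteq> v" if "u \<rightarrow>\<^bsub>G\<^esub> v" for u v
    using that by (auto dest: adj_not_same)
  obtain P where P: "partition_on ?W P"
    and clique: "\<And>K u v. \<lbrakk>K \<in> P; u \<in> K; v \<in> K; u \<noteq> v\<rbrakk> \<Longrightarrow> u \<rightarrow>\<^bsub>G\<^esub> v"
    and apart: "\<And>K L u v. \<lbrakk>K \<in> P; L \<in> P; K \<noteq> L; u \<in> K; v \<in> L\<rbrakk> \<Longrightarrow> \<not> u \<rightarrow>\<^bsub>G\<^esub> v"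
  proof -
    from assms(7) obtain P where P: "partition_on ?W P" "\<forall>K\<in>P. clique (G \<restriction> ?W) K"
      "\<forall>K\<in>P. \<forall>L\<in>P. K \<noteq> L \<longrightarrow> (\<forall>u\<in>K. \<forall>v\<in>L. \<not> u \<rightarrow>\<^bsub>G \<restriction> ?W\<^esub> v)"
      unfolding disjoint_union_of_cliques_def by auto
    have in_W: "u \<in> ?W" if "K \<in> P" "u \<in> K" for K u
      using partition_onD1[OF P(1)] that by blast
    show thesis
    proof (rule that[OF P(1)])
      show "u \<rightarrow>\<^bsub>G\<^esub> v" if "K \<in> P" "u \<in> K" "v \<in> K" "u \<noteq> v" for K u v
        using P(2) that unfolding clique_def dom_sub by blast
      show "\<not> u \<rightarrow>\<^bsub>G\<^esub> v" if "K \<in> P" "L \<in> P" "K \<noteq> L" "u \<in> K" "v \<in> L" for K L u v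
        using P(3) that in_W unfolding dom_sub by metis
    qed
  qed
  have W: "\<Union>P = ?W" using partition_onD1[OF P] by simp
  have disj: "K = L" if "K \<in> P" "L \<in> P" "w \<in> K" "w \<in> L" for K L w
    using partition_onD2[OF P] that unfolding disjoint_def by blast
  have fin_X: "finite X" using assms(4) finite_verts finite_subset by blast
  have X3: "X \<noteq> {}" "\<And>x. \<not> X \<subseteq> {x}"
  proof -
    show "\<not> X \<subseteq> {x}" for x
      using card_mono[of "{x}" X] assms(5,6) by auto
    then show "X \<noteq> {}" by blast
  qed
  have nb_clique: "v \<in> K \<or> v \<in> X" if "K \<in> P" "u \<in> K" "u \<rightarrow>\<^bsub>G\<^esub> v" for K u v
    using apart that vertsD W by (metis DiffI UnionE)
  have nb_X: "v \<in> ?W" if "x \<in> X" "x \<rightarrow>\<^bsub>G\<^esub> v" for x v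
    using that assms(8) vertsD unfolding independent_set_def by blast
  note whole = connected_closed[OF assms(2) sym]
  interpret clustered X P ?S
  proof
    show "finite (\<Union>P)" using W finite_verts by simp
    show "w \<notin> X" if "w \<in> \<Union>P" for w using that W by blast
    show "\<exists>w\<in>K. ?S w \<noteq> {}" if K: "K \<in> P" for K
    proof (rule ccontr)
      assume neg: "\<not> ?thesis"
      have "K \<noteq> {}" using partition_onD3[OF P] K by blast
      moreover have "K \<subseteq> verts G" using W K by blast
      moreover have "v \<in> K" if "u \<in> K" "u \<rightarrow>\<^bsub>G\<^esub> v" for u v
        using nb_clique[OF K that] neg that by blast
      ultimately have "K = verts G" using whole by blast
      then show False using W K assms(4) X3(1) by blast
    qed
    show "\<exists>K\<in>P. (\<exists>w\<in>K. x \<in> ?S w) \<and> (\<exists>v\<in>K. \<not> ?S v \<subseteq> {x})" if x: "x \<in> X" for x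
    proof (rule ccontr)
      assume neg: "\<not> ?thesis"
      \<comment> \<open>If no clique adjacent to \<open>x\<close> had another neighbor in
        \<open>X\<close>, then \<open>x\<close> and these cliques would form a closed set, hence all
        of \<open>G\<close>, although \<open>X\<close> has further elements.\<close>
      define Z where "Z = insert x (\<Union>{K \<in> P. \<exists>w\<in>K. w \<rightarrow>\<^bsub>G\<^esub> x})"
      have "Z \<subseteq> verts G" unfolding Z_def using W x assms(4) by blast
      moreover have "v \<in> Z" if uv: "u \<in> Z" "u \<rightarrow>\<^bsub>G\<^esub> v" for u v
      proof (cases "u = x")
        case True
        then obtain K where "K \<in> P" "v \<in> K" using nb_X x uv(2) W by blast
        moreover have "v \<rightarrow>\<^bsub>G\<^esub> x" using symD uv(2) True by blast
        ultimately show ?thesis unfolding Z_def by blast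
      next
        case False
        then obtain K where K: "K \<in> P" "u \<in> K" "\<exists>w\<in>K. w \<rightarrow>\<^bsub>G\<^esub> x" using uv(1) unfolding Z_def by blast
        have "?S u \<subseteq> {x}" using neg K x by blast
        then show ?thesis using nb_clique[OF K(1,2) uv(2)] uv(2) K unfolding Z_def by blast
      qed
      ultimately have "Z = verts G" using whole[of Z] unfolding Z_def by blast
      then have "X \<subseteq> {x}" using W assms(4) unfolding Z_def by blast
      then show False using X3(2) by blast
    qed
  qed (use fin_X assms(5,6) disj in auto)
  obtain D where D: "conflict_free D" using exists_conflict_free_coloring by blast
  let ?colors = "insert None (Some ` X)"
  have "card ?colors = d + 1"
    using fin_X assms(5) by (simp add: card_image)
  \<comment> \<open>\<open>h\<close> numbers the colors, with \<open>None\<close> accounting for the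
    \<open>+ 1\<close>.\<close>
  then obtain h where h: "bij_betw h ?colors {1..d + 1}"
    using fin_X by (metis finite_insert finite_imageI finite_same_card_bij finite_atLeastAtMost card_atLeastAtMost diff_Suc_1 Suc_eq_plus1)
  have verts: "verts G = X \<union> \<Union>P" using W assms(4) by blast
  have D_colors: "D v \<in> ?colors" if "v \<in> verts G" for v
    using D that unfolding conflict_free_def verts by blast
  have unique: "\<exists>i. \<exists>!u. u \<in> open_neighborhood G v \<and> D u = i" if v: "v \<in> verts G" for v
  proof (cases "v \<in> X")
    case True
    then have "u \<in> open_neighborhood G v \<longleftrightarrow> u \<in> \<Union>P \<and> v \<in> ?S u" for u
      using nb_X symD W vertsD unfolding open_neighborhood_def by blast
    then have "(u \<in> open_neighborhood G v \<and> D u = i) = (u \<in> \<Union>P \<and> v \<in> ?S u \<and> D u = i)" for u i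
      by blast
    then show ?thesis using D True unfolding conflict_free_def by simp
  next
    case False
    then obtain K where K: "K \<in> P" "v \<in> K" using v W by blast
    have "u \<in> open_neighborhood G v \<longleftrightarrow> u \<in> (K - {v}) \<union> ?S v" for u
      using nb_clique[OF K, of u] clique[OF K, of u] vertsD[of v u] unfolding open_neighborhood_def by blast
    then have "open_neighborhood G v = (K - {v}) \<union> ?S v" by blast
    then show ?thesis using D K unfolding conflict_free_def by simp
  qed
  have "CFON_coloring G (d + 1) (h \<circ> D)"
    unfolding CFON_coloring_def
  proof (intro conjI ballI)
    show "(h \<circ> D) ` verts G \<subseteq> {1..d + 1}"
    proof (rule image_subsetI)
      fix v assume "v \<in> verts G"
      then show "(h \<circ> D) v \<in> {1..d + 1}"
        using bij_betw_apply[OF h D_colors] by simp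
    qed
    fix v assume v: "v \<in> verts G"
    obtain i u where u: "u \<in> open_neighborhood G v" "D u = i"
      and uniq: "\<And>w. \<lbrakk>w \<in> open_neighborhood G v; D w = i\<rbrakk> \<Longrightarrow> w = u"
      using unique[OF v] by metis
    have nb_color: "D w \<in> ?colors" if "w \<in> open_neighborhood G v" for w
      by (rule D_colors) (use that in \<open>simp add: open_neighborhood_def\<close>)
    have "w = u" if w: "w \<in> open_neighborhood G v" "h (D w) = h i" for w
    proof -
      have "D w = i"
        using bij_betw_imp_inj_on[OF h] w(2)
        by (rule inj_onD) (use nb_color[OF w(1)] nb_color[OF u(1)] u(2) in simp_all)
      then show ?thesis using uniq w(1) by simp
    qed
    then have "w \<in> open_neighborhood G v \<and> (h \<circ> D) w = h i \<longleftrightarrow> w = u" for w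
      using u unfolding comp_apply by metis
    then have "card {w \<in> open_neighborhood G v. (h \<circ> D) w = h i} = 1" by simp
    moreover have "h i \<in> {1..d + 1}" using bij_betw_apply[OF h nb_color[OF u(1)]] u(2) by simp
    ultimately show "\<exists>i\<in>{1..d + 1}. card {u \<in> open_neighborhood G v. (h \<circ> D) u = i} = 1"
      by (rule bexI)
  qed
  then show ?thesis by (rule chi_ON_le)
qed

end
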